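(* Let $\gamma\in[-1,1]$. For every fixed $\eta=(\eta_1,\eta_2)\in\mathbb{R}^2\setminus\{0\}$, the unique solution $(\hat u,\hat p)=(\hat u_1,\hat u_2,\hat u_3,\hat p)$ on $t>0$ of $$\Bigl(\frac{d^2}{dt^2}-|\eta|^2\Bigr)^2\hat u_j+i\eta_j\hat p=0\ (j=1,2),\qquad \Bigl(\frac{d^2}{dt^2}-|\eta|^2\Bigr)^2\hat u_3+\frac{d\hat p}{dt}=0,\qquad \frac{d\hat u_3}{dt}+i\eta_1\hat u_1+i\eta_2\hat u_2=0$$ that decays as $t\to+\infty$ and satisfies at $t=0$ the homogeneous principal boundary conditions $$\hat u_1=\hat u_2=\hat u_3=0,$$ $$\frac{d^2\hat u_2}{dt^2}-i\eta_2\frac{d\hat u_3}{dt}+\gamma\eta_1(\eta_2\hat u_1-\eta_1\hat u_2)=0,$$ $$\frac{d^2\hat u_1}{dt^2}-i\eta_1\frac{d\hat u_3}{dt}+\gamma\eta_2(\eta_2\hat u_1-\eta_1\hat u_2)=0$$ is the trivial solution $\hat u\equiv 0$, $\hat p\equiv 0$. Consequently, the Dirichlet--wall--eddy boundary value problem associated with $L(\partial)$ satisfies the Lopatinskii--Shapiro covering condition.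
   Context: The operator is $$L(\partial)=\begin{bmatrix}\Delta^2&0&0&\partial_1\\0&\Delta^2&0&\partial_2\\0&0&\Delta^2&\partial_3\\ \partial_1&\partial_2&\partial_3&0\end{bmatrix}$$ acting on $U=(u_1,u_2,u_3,p)^\top$, with Douglis--Nirenberg orders $s=(4,4,4,1)$ for equations and $t=(0,0,0,-3)$ for unknowns. The Dirichlet--wall--eddy boundary conditions are $u=0$ and $(1-n\otimes n)Gn-k\omega=0$ on the boundary, with $\omega=\nabla\times u$, $G=\nabla\omega+\gamma(\nabla\omega)^\top$, $(\nabla\omega)_{ij}=\partial_j\omega_i$, $n$ the outward unit normal, $k>0$ a constant; they are five scalar conditions of orders $(0,0,0,2,2)$. After flattening the boundary near a point one works in the half-space $\{x_3>0\}$, $n=-e_3$, $t=x_3$, where the principal parts $B^0$ of the boundary conditions (terms of exactly the top order) are $u=0$, $\partial_3\omega_1+\gamma\partial_1\omega_3=0$, $\partial_3\omega_2+\gamma\partial_2\omega_3=0$. Taking the Fourier transform in the tangential variables $(x_1,x_2)\to\eta$ turns $L(\partial)U=0$ into the ODE system $L(i\eta,d/dt)\hat U=0$. The Lopatinskii--Shapiro covering condition is: for any fixed $\eta\in\mathbb{R}^2\setminus\{0\}$, the only solution $\hat U(\eta,t)$ on $t>0$ of $L(i\eta,d/dt)\hat U=0$ that decays as $t\to+\infty$ and satisfies $B^0(i\eta,d/dt)\hat U|_{t=0}=0$ is $\hat U(\eta,\cdot)\equiv 0$. *)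

theory Defs
  imports "HOL-Analysis.Analysis" "HOL-Library.Poly_Mapping"
begin

section \<open>Constant-coefficient differential operators on three-dimensional space\<close>

text \<open>
  A scalar operator \<open>\<Sum>\<^sub>\<alpha> c\<^sub>\<alpha> \<partial>\<^sup>\<alpha>\<close> is the finitely supported family of its coefficients, indexed by
  multi-indices \<open>\<alpha>\<close>. Composition of operators is the (convolution) product of \<open>poly_mapping\<close>.
\<close>

type_synonym diffop = "(nat ^ 3) \<Rightarrow>\<^sub>0 complex"

definition pd :: "3 \<Rightarrow> diffop" where
  "pd i = Poly_Mapping.single (axis i 1) 1"

definition cst :: "real \<Rightarrow> diffop" where
  "cst c = Poly_Mapping.single 0 (complex_of_real c)"

definition laplacian :: diffop where
  "laplacian = (\<Sum>i\<in>UNIV. pd i ^ 2)"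

definition mdeg :: "nat ^ 3 \<Rightarrow> nat" where
  "mdeg \<alpha> = (\<Sum>i\<in>UNIV. \<alpha> $ i)"

text \<open>The homogeneous part of order \<open>d\<close>; it is zero for negative \<open>d\<close>.\<close>

definition hom_part :: "int \<Rightarrow> diffop \<Rightarrow> diffop" where
  "hom_part d P = (\<Sum>\<alpha> | \<alpha> \<in> Poly_Mapping.keys P \<and> int (mdeg \<alpha>) = d.
     Poly_Mapping.single \<alpha> (Poly_Mapping.lookup P \<alpha>))"

text \<open>
  Douglis--Nirenberg principal part of a matrix operator: with weights \<open>s\<close> for the rows (equations
  or boundary conditions) and \<open>t\<close> for the unknowns, the entry \<open>(i, j)\<close> keeps exactly its terms of
  order \<open>s\<^sub>i + t\<^sub>j\<close>.
\<close>

definition principal_part ::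
    "int ^ 'r \<Rightarrow> int ^ 'c \<Rightarrow> diffop ^ 'c ^ 'r \<Rightarrow> diffop ^ 'c ^ 'r" where
  "principal_part s t A = (\<chi> i j. hom_part (s $ i + t $ j) (A $ i $ j))"


section \<open>The covering condition on the half-space\<close>

definition vderiv :: "(real \<Rightarrow> 'a::real_normed_vector) \<Rightarrow> real \<Rightarrow> 'a" where
  "vderiv f t = vector_derivative f (at t)"

definition times_differentiable_pos :: "nat \<Rightarrow> (real \<Rightarrow> complex) \<Rightarrow> bool" where
  "times_differentiable_pos m f \<longleftrightarrow> (\<forall>k<m. \<forall>t>0. (vderiv ^^ k) f differentiable (at t))"

text \<open>
  \<open>P(i\<eta>, d/dt) f\<close>: the tangential derivatives \<open>\<partial>\<^sub>1, \<partial>\<^sub>2\<close> become multiplication by \<open>i\<eta>\<^sub>1, i\<eta>\<^sub>2\<close>,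
  while \<open>\<partial>\<^sub>3\<close> becomes \<open>d/dt\<close>.
\<close>

definition apply_op :: "real ^ 2 \<Rightarrow> diffop \<Rightarrow> (real \<Rightarrow> complex) \<Rightarrow> real \<Rightarrow> complex" where
  "apply_op \<eta> P f t = (\<Sum>\<alpha>\<in>Poly_Mapping.keys P.
     Poly_Mapping.lookup P \<alpha> * (\<i> * of_real (\<eta> $ 1)) ^ (\<alpha> $ 1) * (\<i> * of_real (\<eta> $ 2)) ^ (\<alpha> $ 2)
       * (vderiv ^^ (\<alpha> $ 3)) f t)"

definition apply_mat ::
    "real ^ 2 \<Rightarrow> diffop ^ 'c ^ 'r \<Rightarrow> (real \<Rightarrow> complex ^ 'c) \<Rightarrow> real \<Rightarrow> complex ^ 'r" where
  "apply_mat \<eta> A U t = (\<chi> i. \<Sum>j\<in>UNIV. apply_op \<eta> (A $ i $ j) (\<lambda>x. U x $ j) t)"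

text \<open>All normal derivatives that occur in \<open>A(i\<eta>, d/dt) U\<close> exist classically on \<open>t > 0\<close>.\<close>

definition regular_for :: "diffop ^ 'c ^ 'r \<Rightarrow> (real \<Rightarrow> complex ^ 'c) \<Rightarrow> bool" where
  "regular_for A U \<longleftrightarrow>
     (\<forall>i j. \<forall>\<alpha>\<in>Poly_Mapping.keys (A $ i $ j). times_differentiable_pos (\<alpha> $ 3) (\<lambda>x. U x $ j))"

text \<open>
  Only the restriction of \<open>U\<close> to \<open>t > 0\<close> is constrained; boundary values at \<open>t = 0\<close> are limits
  as \<open>t\<close> tends to \<open>0\<close> from the right.
\<close>

definition covering_condition :: "diffop ^ 'c ^ 'e \<Rightarrow> diffop ^ 'c ^ 'b \<Rightarrow> bool" where
  "covering_condition L B0 \<longleftrightarrow>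
     (\<forall>\<eta>::real ^ 2. \<eta> \<noteq> 0 \<longrightarrow>
       (\<forall>U::real \<Rightarrow> complex ^ 'c.
          (regular_for L U \<and> regular_for B0 U \<and>
           (\<forall>t>0. apply_mat \<eta> L U t = 0) \<and>
           (U \<longlongrightarrow> 0) at_top \<and>
           (apply_mat \<eta> B0 U \<longlongrightarrow> 0) (at_right 0))
          \<longleftrightarrow> (\<forall>t>0. U t = 0)))"


section \<open>The Dirichlet--wall--eddy problem\<close>

text \<open>The unknowns are \<open>U = (u\<^sub>1, u\<^sub>2, u\<^sub>3, p)\<close>.\<close>

definition L_op :: "diffop ^ 4 ^ 4" where
  "L_op = vector [
     vector [laplacian ^ 2, 0, 0, pd 1],
     vector [0, laplacian ^ 2, 0, pd 2],
     vector [0, 0, laplacian ^ 2, pd 3],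
     vector [pd 1, pd 2, pd 3, 0]]"

definition eq_orders :: "int ^ 4" where "eq_orders = vector [4, 4, 4, 1]"
definition unk_orders :: "int ^ 4" where "unk_orders = vector [0, 0, 0, -3]"
definition bc_orders :: "int ^ 5" where "bc_orders = vector [0, 0, 0, 2, 2]"

text \<open>
  A scalar linear differential expression in \<open>U\<close> is a row of type \<open>diffop ^ 4\<close>; a vector field
  depending linearly on \<open>U\<close> is a triple of such rows.
\<close>

type_synonym row = "diffop ^ 4"

definition u_field :: "row ^ 3" where
  "u_field = vector [axis 1 1, axis 2 1, axis 3 1]"

definition curl :: "row ^ 3 \<Rightarrow> row ^ 3" where
  "curl v = vector [
     pd 2 *s v $ 3 - pd 3 *s v $ 2,
     pd 3 *s v $ 1 - pd 1 *s v $ 3,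
     pd 1 *s v $ 2 - pd 2 *s v $ 1]"

definition grad :: "row ^ 3 \<Rightarrow> row ^ 3 ^ 3" where
  "grad v = (\<chi> i j. pd j *s v $ i)"

definition G_field :: "real \<Rightarrow> row ^ 3 ^ 3" where
  "G_field \<gamma> = (let W = grad (curl u_field) in \<chi> i j. W $ i $ j + cst \<gamma> *s W $ j $ i)"

text \<open>The field \<open>(1 - n \<otimes> n) G n - k \<omega>\<close>.\<close>

definition wall_eddy :: "real \<Rightarrow> real \<Rightarrow> real ^ 3 \<Rightarrow> row ^ 3" where
  "wall_eddy \<gamma> k n =
     (let Gn = (\<chi> i. \<Sum>j\<in>UNIV. cst (n $ j) *s G_field \<gamma> $ i $ j) :: row ^ 3
      in \<chi> i. Gn $ i - cst (n $ i) *s (\<Sum>j\<in>UNIV. cst (n $ j) *s Gn $ j)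
             - cst k *s curl u_field $ i)"

definition half_space_normal :: "real ^ 3" where
  "half_space_normal = - axis 3 1"

text \<open>
  The five scalar boundary conditions on \<open>{x\<^sub>3 > 0}\<close>: \<open>u = 0\<close> and the two tangential components of
  the wall--eddy condition. Its normal component reduces to \<open>k \<omega> \<bullet> n = 0\<close>, which is a tangential
  consequence of \<open>u = 0\<close> and not a separate condition.
\<close>

definition B_op :: "real \<Rightarrow> real \<Rightarrow> diffop ^ 4 ^ 5" where
  "B_op \<gamma> k = vector [
     u_field $ 1, u_field $ 2, u_field $ 3,
     wall_eddy \<gamma> k half_space_normal $ 1,
     wall_eddy \<gamma> k half_space_normal $ 2]"

text \<open>The operator \<open>d\<^sup>2/dt\<^sup>2 - |\<eta>|\<^sup>2\<close>.\<close>

definition helm :: "real ^ 2 \<Rightarrow> (real \<Rightarrow> complex) \<Rightarrow> real \<Rightarrow> complex" where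
  "helm \<eta> f t = (vderiv ^^ 2) f t - of_real ((norm \<eta>)\<^sup>2) * f t"


section \<open>Consistency of the orders\<close>

definition homogeneous :: "int \<Rightarrow> diffop \<Rightarrow> bool" where
  "homogeneous d P \<longleftrightarrow> (\<forall>\<alpha>. Poly_Mapping.lookup P \<alpha> \<noteq> 0 \<longrightarrow> int (mdeg \<alpha>) = d)"

lemma vector_4:
  "(vector [a, b, c, d] :: 'a::zero ^ 4) $ 1 = a"
  "(vector [a, b, c, d] :: 'a::zero ^ 4) $ 2 = b"
  "(vector [a, b, c, d] :: 'a::zero ^ 4) $ 3 = c"
  "(vector [a, b, c, d] :: 'a::zero ^ 4) $ 4 = d"
  unfolding vector_def by simp_all

lemma vector_5:
  "(vector [a, b, c, d, e] :: 'a::zero ^ 5) $ 1 = a"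
  "(vector [a, b, c, d, e] :: 'a::zero ^ 5) $ 2 = b"
  "(vector [a, b, c, d, e] :: 'a::zero ^ 5) $ 3 = c"
  "(vector [a, b, c, d, e] :: 'a::zero ^ 5) $ 4 = d"
  "(vector [a, b, c, d, e] :: 'a::zero ^ 5) $ 5 = e"
  unfolding vector_def by simp_all

lemma forall_5: "(\<forall>i::5. P i) \<longleftrightarrow> P 1 \<and> P 2 \<and> P 3 \<and> P 4 \<and> P 5"
proof -
  have "i = 1 \<or> i = 2 \<or> i = 3 \<or> i = 4 \<or> i = 5" for i :: 5
  proof (induct i)
    case (of_int z)
    then have "0 \<le> z" and "z < 5" by simp_all
    then have "z = 0 \<or> z = 1 \<or> z = 2 \<or> z = 3 \<or> z = 4" by arith
    then show ?case by auto
  qed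
  then show ?thesis by metis
qed

lemma lookup_hom_part:
  "Poly_Mapping.lookup (hom_part d P) \<alpha> = (if int (mdeg \<alpha>) = d then Poly_Mapping.lookup P \<alpha> else 0)"
proof -
  have "Poly_Mapping.lookup (hom_part d P) \<alpha> =
    (\<Sum>\<beta> | \<beta> \<in> Poly_Mapping.keys P \<and> int (mdeg \<beta>) = d. if \<beta> = \<alpha> then Poly_Mapping.lookup P \<alpha> else 0)"
    by (auto simp: hom_part_def lookup_sum lookup_single when_def intro!: sum.cong)
  also have "\<dots> = (if int (mdeg \<alpha>) = d then Poly_Mapping.lookup P \<alpha> else 0)"
    by (auto simp: sum.delta' in_keys_iff)
  finally show ?thesis .
qed

lemma hom_part_add: "hom_part d (P + Q) = hom_part d P + hom_part d Q"
  by (rule poly_mapping_eqI) (simp add: lookup_hom_part lookup_add)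

lemma hom_part_uminus: "hom_part d (- P) = - hom_part d P"
  by (rule poly_mapping_eqI) (simp add: lookup_hom_part)

lemma hom_part_diff: "hom_part d (P - Q) = hom_part d P - hom_part d Q"
  by (rule poly_mapping_eqI) (simp add: lookup_hom_part lookup_minus)

lemma hom_part_zero: "hom_part d 0 = 0"
  by (rule poly_mapping_eqI) (simp add: lookup_hom_part)

lemma hom_part_homogeneous: "homogeneous e P \<Longrightarrow> hom_part d P = (if d = e then P else 0)"
  by (rule poly_mapping_eqI) (auto simp: lookup_hom_part homogeneous_def)

lemma mdeg_add: "mdeg (\<alpha> + \<beta>) = mdeg \<alpha> + mdeg \<beta>"
  by (simp add: mdeg_def sum.distrib)

lemma mdeg_axis: "mdeg (axis i 1) = 1"
  by (simp add: mdeg_def axis_def del: One_nat_def)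

lemma homogeneous_pd: "homogeneous 1 (pd i)"
  by (auto simp: homogeneous_def pd_def lookup_single when_def mdeg_axis simp del: One_nat_def)

lemma homogeneous_cst: "homogeneous 0 (cst c)"
  by (auto simp: homogeneous_def cst_def lookup_single when_def mdeg_def)

lemma homogeneous_add: "homogeneous d P \<Longrightarrow> homogeneous d Q \<Longrightarrow> homogeneous d (P + Q)"
  unfolding homogeneous_def lookup_add by (metis add.right_neutral)

lemma homogeneous_mult:
  assumes "homogeneous d P" "homogeneous e Q"
  shows "homogeneous (d + e) (P * Q)"
  unfolding homogeneous_def
proof (intro allI impI)
  fix \<alpha> assume "Poly_Mapping.lookup (P * Q) \<alpha> \<noteq> 0"
  then have "\<alpha> \<in> Poly_Mapping.keys (P * Q)" by (simp add: in_keys_iff)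
  then obtain \<beta> \<delta> where "\<beta> \<in> Poly_Mapping.keys P" "\<delta> \<in> Poly_Mapping.keys Q" "\<alpha> = \<beta> + \<delta>"
    using keys_mult by blast
  then show "int (mdeg \<alpha>) = d + e"
    using assms by (auto simp: homogeneous_def in_keys_iff mdeg_add)
qed

lemma homogeneous_laplacian: "homogeneous 2 laplacian"
proof -
  have "homogeneous 2 (pd i ^ 2)" for i
    using homogeneous_mult[OF homogeneous_pd homogeneous_pd, of i i] by (simp add: power2_eq_square)
  then show ?thesis
    by (simp add: laplacian_def sum_3 homogeneous_add)
qed

text \<open>\<open>L\<close> consists of its principal part only, so it may be used as it is in the covering condition.\<close>

lemma principal_part_L_op: "principal_part eq_orders unk_orders L_op = L_op"
proof -
  have 1: "hom_part 4 (laplacian ^ 2) = laplacian ^ 2"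
    using homogeneous_mult[OF homogeneous_laplacian homogeneous_laplacian]
    by (simp add: hom_part_homogeneous power2_eq_square)
  have 2: "hom_part 1 (pd i) = pd i" for i
    by (simp add: hom_part_homogeneous[OF homogeneous_pd])
  show ?thesis
    by (simp add: vec_eq_iff forall_4 vector_4 principal_part_def eq_orders_def unk_orders_def L_op_def
        1 2 hom_part_zero)
qed

text \<open>
  The principal boundary operator: \<open>u\<close>, and, up to the sign caused by \<open>n = -e\<^sub>3\<close>,
  \<open>\<partial>\<^sub>3 \<omega>\<^sub>j + \<gamma> \<partial>\<^sub>j \<omega>\<^sub>3\<close> for \<open>j = 1, 2\<close>.
\<close>

lemma principal_part_B_op:
  "principal_part bc_orders unk_orders (B_op \<gamma> k) =
     (let \<omega> = curl u_field in vector [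
        u_field $ 1, u_field $ 2, u_field $ 3,
        - (pd 3 *s \<omega> $ 1 + cst \<gamma> *s (pd 1 *s \<omega> $ 3)),
        - (pd 3 *s \<omega> $ 2 + cst \<gamma> *s (pd 2 *s \<omega> $ 3))])"
proof -
  have c: "cst 0 = 0" "cst (-1) = -1" "cst 1 = 1"
    by (simp_all add: cst_def single_uminus)
  have d2: "hom_part 2 (pd i * pd j) = pd i * pd j" for i j
    using homogeneous_mult[OF homogeneous_pd homogeneous_pd, of i j] by (simp add: hom_part_homogeneous)
  have d2c: "hom_part 2 (cst g * (pd i * pd j)) = cst g * (pd i * pd j)" for i j g
    using homogeneous_mult[OF homogeneous_cst homogeneous_mult[OF homogeneous_pd homogeneous_pd], of g i j]
    by (simp add: hom_part_homogeneous)
  have d1: "hom_part 2 (cst g * pd i) = 0" for i g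
    using homogeneous_mult[OF homogeneous_cst homogeneous_pd, of g i] by (simp add: hom_part_homogeneous)
  have d0: "hom_part 0 (1::diffop) = 1"
    using homogeneous_cst[of 1] by (simp add: hom_part_homogeneous c)
  show ?thesis
    by (simp add: vec_eq_iff forall_5 forall_4 vector_4 vector_5 vector_3 principal_part_def bc_orders_def unk_orders_def B_op_def
        Let_def u_field_def curl_def wall_eddy_def G_field_def grad_def half_space_normal_def
        axis_def sum_3 forall_3 c d0 d1 d2 d2c hom_part_zero hom_part_add hom_part_uminus
        hom_part_diff algebra_simps)
qed

end

theory Submission
  imports Defs "HOL-Real_Asymp.Real_Asymp"
begin

text \<open>
  Write \<open>r = |\<eta>| > 0\<close> and \<open>D = d/dt\<close>. The divergence of the three momentum equations, combined with
  \<open>Du\<^sub>3 + i\<eta>\<^sub>1u\<^sub>1 + i\<eta>\<^sub>2u\<^sub>2 = 0\<close>, eliminates the velocity and leaves \<open>p'' = r\<^sup>2 p\<close>, so decay forces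
  \<open>p = c e\<^sup>-\<^sup>r\<^sup>t\<close>. Each velocity component then solves \<open>(D\<^sup>2 - r\<^sup>2)\<^sup>2 u\<^sub>j = const \<cdot> e\<^sup>-\<^sup>r\<^sup>t\<close>, a resonant
  equation whose decaying solutions are \<open>u\<^sub>j = (a\<^sub>j + b\<^sub>j t + d\<^sub>j t\<^sup>2) e\<^sup>-\<^sup>r\<^sup>t\<close>
  (\<^emph>\<open>decaying_biharmonic\<close>), where only \<open>d\<^sub>j\<close> is tied to \<open>c\<close>:
  \<open>8r\<^sup>2 d\<^sub>j = -i\<eta>\<^sub>j c\<close> for \<open>j = 1, 2\<close> and \<open>8r d\<^sub>3 = c\<close>.

  At \<open>t = 0\<close> the condition \<open>u = 0\<close> gives \<open>a\<^sub>j = 0\<close> and, through the divergence equation, also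
  \<open>Du\<^sub>3 = 0\<close>. Hence every term of the wall-eddy conditions except the second derivative tends to \<open>0\<close>,
  and these conditions say \<open>D\<^sup>2u\<^sub>1 = D\<^sup>2u\<^sub>2 = 0\<close> (\<^emph>\<open>wall_eddy_second_trace\<close>), that is
  \<open>r b\<^sub>j = d\<^sub>j\<close> for \<open>j = 1, 2\<close>. Comparing the coefficients of \<open>t\<close> in the divergence equation yields
  \<open>2d\<^sub>3 = -i\<eta>\<^sub>1b\<^sub>1 - i\<eta>\<^sub>2b\<^sub>2\<close>; here the left side is \<open>c/(4r)\<close> and the right side \<open>-c/(8r)\<close>, so \<open>c = 0\<close>
  and everything vanishes (\<^emph>\<open>half_space_system_trivial\<close>).

  The covering condition is the same statement about the symbol-level operators: evaluating
  \<open>L(i\<eta>, D)\<close> and \<open>B\<^sup>0(i\<eta>, D)\<close> on the coefficients of the polynomial mappings gives back this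
  system. The sign of the \<open>\<gamma>\<close>-term obtained from \<open>\<partial>\<^sub>3\<omega>\<^sub>1 + \<gamma>\<partial>\<^sub>1\<omega>\<^sub>3\<close> is opposite to the one in the
  scalar form, which is harmless because this term vanishes at the boundary.
\<close>

section \<open>Iterated derivatives on the open half-line\<close>

lemma has_vector_derivative_vderiv_funpow:
  assumes "times_differentiable_pos m f" "k < m" "t > 0"
  shows "((vderiv ^^ k) f has_vector_derivative (vderiv ^^ Suc k) f t) (at t)"
  using assms by (auto simp: times_differentiable_pos_def vderiv_def vector_derivative_works)

text \<open>
  The function \<open>vderiv f\<close> at \<open>t\<close> depends on the germ of \<open>f\<close> at \<open>t\<close> only, so identities valid on the open
  half-line may be differentiated although nothing is known for \<open>t \<le> 0\<close>.
\<close>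

lemma vderiv_funpow_cong_pos:
  assumes "\<And>t. t > 0 \<Longrightarrow> f t = g t" "t > 0"
  shows "(vderiv ^^ k) f t = (vderiv ^^ k) g t"
  using assms(2)
proof (induction k arbitrary: t)
  case (Suc k)
  have "\<forall>\<^sub>F x in nhds t. (vderiv ^^ k) f x = (vderiv ^^ k) g x"
    using eventually_nhds_in_open[of "{0<..}" t] Suc by (auto elim!: eventually_mono)
  then have "vderiv ((vderiv ^^ k) f) t = vderiv ((vderiv ^^ k) g) t"
    unfolding vderiv_def by (intro vector_derivative_cong_eq) auto
  then show ?case by simp
qed (use assms in auto)

lemma times_differentiable_pos_zero:
  assumes "\<And>t. t > 0 \<Longrightarrow> f t = 0"
  shows "times_differentiable_pos m f" "\<And>t. t > 0 \<Longrightarrow> (vderiv ^^ k) f t = 0"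
proof -
  have z: "(vderiv ^^ k) (\<lambda>_. 0 :: complex) = (\<lambda>_. 0)" for k
    by (induction k) (auto simp: vderiv_def)
  show *: "(vderiv ^^ k) f t = 0" if "t > 0" for t k
    using vderiv_funpow_cong_pos[of f "\<lambda>_. 0" t k] assms that z by simp
  show "times_differentiable_pos m f"
    unfolding times_differentiable_pos_def
  proof (intro allI impI)
    fix k :: nat and t :: real assume "t > 0"
    have "((vderiv ^^ k) f has_vector_derivative 0) (at t)"
      by (rule has_vector_derivative_transform_within_open[of "\<lambda>_. 0" _ _ "{0<..}"])
        (use * \<open>t > 0\<close> in auto)
    then show "(vderiv ^^ k) f differentiable at t"
      by (rule differentiableI_vector)
  qed
qed

lemma vderiv_funpow_lincomb:
  fixes f g :: "real \<Rightarrow> complex"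
  assumes "times_differentiable_pos m f" "times_differentiable_pos m g" "k \<le> m" "t > 0"
  shows "(vderiv ^^ k) (\<lambda>x. a * f x + b * g x) t = a * (vderiv ^^ k) f t + b * (vderiv ^^ k) g t"
  using assms(3,4)
proof (induction k arbitrary: t)
  case (Suc k)
  have "((\<lambda>x. a * (vderiv ^^ k) f x + b * (vderiv ^^ k) g x) has_vector_derivative
      a * (vderiv ^^ Suc k) f t + b * (vderiv ^^ Suc k) g t) (at t)"
    using assms Suc.prems
    by (intro has_vector_derivative_add has_vector_derivative_mult_right
        has_vector_derivative_vderiv_funpow[where m = m]) auto
  then have "((vderiv ^^ k) (\<lambda>x. a * f x + b * g x) has_vector_derivative
      a * (vderiv ^^ Suc k) f t + b * (vderiv ^^ Suc k) g t) (at t)"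
    by (rule has_vector_derivative_transform_within_open[of _ _ _ "{0<..}"])
      (use Suc in auto)
  then have "vderiv ((vderiv ^^ k) (\<lambda>x. a * f x + b * g x)) t
      = a * (vderiv ^^ Suc k) f t + b * (vderiv ^^ Suc k) g t"
    unfolding vderiv_def[of "(vderiv ^^ k) (\<lambda>x. a * f x + b * g x)"] by (rule vector_derivative_at)
  then show ?case by simp
qed simp

lemma helm_helm:
  assumes "times_differentiable_pos 4 f" "t > 0"
  shows "helm \<eta> (helm \<eta> f) t =
    (vderiv ^^ 4) f t - 2 * of_real ((norm \<eta>)\<^sup>2) * (vderiv ^^ 2) f t
      + of_real ((norm \<eta>)\<^sup>2) ^ 2 * f t"
proof -
  have "(vderiv ^^ (k + 2)) f = (vderiv ^^ k) ((vderiv ^^ 2) f)" for k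
    by (simp only: funpow_add comp_apply)
  moreover have "(vderiv ^^ (k + 2)) f differentiable at x" if "k < 2" "x > 0" for k x
    using assms that by (auto simp: times_differentiable_pos_def simp del: funpow.simps add_2_eq_Suc')
  ultimately have "times_differentiable_pos 2 ((vderiv ^^ 2) f)"
    unfolding times_differentiable_pos_def by metis
  moreover have "times_differentiable_pos 2 f"
    using assms by (auto simp: times_differentiable_pos_def)
  ultimately have d: "times_differentiable_pos 2 ((vderiv ^^ 2) f)" "times_differentiable_pos 2 f" .
  have "(vderiv ^^ 2) (helm \<eta> f) t
      = (vderiv ^^ 2) (\<lambda>x. 1 * (vderiv ^^ 2) f x + - of_real ((norm \<eta>)\<^sup>2) * f x) t"
    using assms by (intro vderiv_funpow_cong_pos) (auto simp: helm_def)
  also have "\<dots> = 1 * (vderiv ^^ 2) ((vderiv ^^ 2) f) t + - of_real ((norm \<eta>)\<^sup>2) * (vderiv ^^ 2) f t"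
    using d assms by (intro vderiv_funpow_lincomb[where m = 2]) auto
  finally have "(vderiv ^^ 2) (helm \<eta> f) t = (vderiv ^^ 4) f t - of_real ((norm \<eta>)\<^sup>2) * (vderiv ^^ 2) f t"
    by (simp add: eval_nat_numeral)
  then show ?thesis
    unfolding helm_def[of \<eta> "helm \<eta> f"] by (simp add: helm_def algebra_simps power2_eq_square)
qed

lemma vanishing_on_pos:
  fixes f :: "real \<Rightarrow> 'a::real_normed_vector"
  assumes "\<And>t. t > 0 \<Longrightarrow> f t = 0"
  shows "(f \<longlongrightarrow> 0) at_top" "(f \<longlongrightarrow> 0) (at_right 0)"
proof -
  have "\<forall>\<^sub>F t in at_top. f t = 0"
    using eventually_gt_at_top[of "0::real"] by eventually_elim (rule assms)
  then show "(f \<longlongrightarrow> 0) at_top" by (rule tendsto_eventually)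
  have "\<forall>\<^sub>F t in at_right 0. f t = 0"
    using eventually_at_right_less[of "0::real"] by eventually_elim (rule assms)
  then show "(f \<longlongrightarrow> 0) (at_right 0)" by (rule tendsto_eventually)
qed

section \<open>Quasipolynomial solutions of the Helmholtz and biharmonic equations\<close>

lemma constant_on_pos:
  fixes f :: "real \<Rightarrow> complex"
  assumes "\<And>t. t > 0 \<Longrightarrow> (f has_vector_derivative 0) (at t)"
  obtains c where "\<And>t. t > 0 \<Longrightarrow> f t = c"
proof -
  have "\<exists>c. \<forall>t\<in>{0<..}. f t = c"
    using has_vector_derivative_zero_constant[of "{0<..}" f] assms
    by (metis convex_real_interval(3) greaterThan_iff has_vector_derivative_at_within)
  then show ?thesis using that by auto
qed

lemma has_vector_derivative_complex_of_real: "(complex_of_real has_vector_derivative 1) (at t)"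
  using has_vector_derivative_of_real[OF DERIV_ident] by simp

lemma has_vector_derivative_exp_of_real:
  "((\<lambda>t. complex_of_real (exp (r * t))) has_vector_derivative of_real r * of_real (exp (r * t))) (at t within S)"
proof -
  have "((\<lambda>t. exp (r * t)) has_real_derivative r * exp (r * t)) (at t within S)"
    by (auto intro!: derivative_eq_intros)
  from has_vector_derivative_of_real[OF this] show ?thesis by simp
qed

text \<open>
  The coefficients of \<open>e\<^sup>r\<^sup>t\<close> and \<open>e\<^sup>-\<^sup>r\<^sup>t\<close> can be read off as the first integrals
  \<open>e\<^sup>-\<^sup>r\<^sup>t (f' + r f)\<close> and \<open>e\<^sup>r\<^sup>t (r f - f')\<close>, which are constant because \<open>f'' = r\<^sup>2 f\<close>.
\<close>

lemma helmholtz_homogeneous: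
  fixes f f' :: "real \<Rightarrow> complex"
  assumes r: "r > 0"
    and f: "\<And>t. t > 0 \<Longrightarrow> (f has_vector_derivative f' t) (at t)"
    and f': "\<And>t. t > 0 \<Longrightarrow> (f' has_vector_derivative of_real r ^ 2 * f t) (at t)"
  obtains A B where "\<And>t. t > 0 \<Longrightarrow> f t = A * of_real (exp (r * t)) + B * of_real (exp (- r * t))"
proof -
  let ?r = "complex_of_real r"
  have "((\<lambda>t. of_real (exp (- r * t)) * (f' t + ?r * f t)) has_vector_derivative 0) (at t)" if "t > 0" for t
    by (rule derivative_eq_intros has_vector_derivative_exp_of_real f[OF that] f'[OF that] refl)+
      (simp add: algebra_simps power2_eq_square)
  from constant_on_pos[OF this]
  obtain K where K: "\<And>t. t > 0 \<Longrightarrow> of_real (exp (- r * t)) * (f' t + ?r * f t) = K"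
    by blast
  have "((\<lambda>t. of_real (exp (r * t)) * (?r * f t - f' t)) has_vector_derivative 0) (at t)" if "t > 0" for t
    by (rule derivative_eq_intros has_vector_derivative_exp_of_real f[OF that] f'[OF that] refl)+
      (simp add: algebra_simps power2_eq_square)
  from constant_on_pos[OF this]
  obtain C where C: "\<And>t. t > 0 \<Longrightarrow> of_real (exp (r * t)) * (?r * f t - f' t) = C"
    by blast
  have "f t = K / (2 * ?r) * of_real (exp (r * t)) + C / (2 * ?r) * of_real (exp (- r * t))"
    if "t > 0" for t
  proof -
    have e: "complex_of_real (exp (r * t)) * of_real (exp (- r * t)) = 1"
      by (simp flip: of_real_mult exp_add)
    have "K * of_real (exp (r * t)) + C * of_real (exp (- r * t))
      = (complex_of_real (exp (r * t)) * of_real (exp (- r * t))) * (2 * ?r * f t)"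
      unfolding K[OF that, symmetric] C[OF that, symmetric] by (simp add: algebra_simps)
    then show ?thesis using r unfolding e by (simp add: field_simps)
  qed
  then show ?thesis by (rule that)
qed

text \<open>
  The forcing terms are themselves solutions of the homogeneous equation (or such a solution times
  \<open>t\<close>), so the particular solution gains one power of \<open>t\<close>. Its coefficients come from
  \<open>(D\<^sup>2 - r\<^sup>2)(t e\<^sup>\<plusminus>\<^sup>r\<^sup>t) = \<plusminus>2r e\<^sup>\<plusminus>\<^sup>r\<^sup>t\<close> and \<open>(D\<^sup>2 - r\<^sup>2)(t\<^sup>2 e\<^sup>-\<^sup>r\<^sup>t) = (2 - 4rt) e\<^sup>-\<^sup>r\<^sup>t\<close>. The growing
  exponential is kept in the forcing because the intermediate function \<open>u'' - r\<^sup>2 u\<close> of the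
  biharmonic equation is not known to decay. The constant \<open>b\<close> is given explicitly since it carries
  the forcing on to the second integration.
\<close>

lemma helmholtz_resonant:
  fixes f f' :: "real \<Rightarrow> complex"
  assumes r: "r > 0"
    and f: "\<And>t. t > 0 \<Longrightarrow> (f has_vector_derivative f' t) (at t)"
    and f': "\<And>t. t > 0 \<Longrightarrow> (f' has_vector_derivative of_real r ^ 2 * f t
        + (K * of_real (exp (r * t)) + (C + D * of_real t) * of_real (exp (- r * t)))) (at t)"
  obtains A B b where "\<And>t. t > 0 \<Longrightarrow> f t =
      (A + K / (2 * of_real r) * of_real t) * of_real (exp (r * t))
      + (B + b * of_real t - D / (4 * of_real r) * of_real t ^ 2) * of_real (exp (- r * t))"
    "b = - (C + D / (2 * of_real r)) / (2 * of_real r)"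
proof -
  let ?r = "complex_of_real r"
  define k where "k = K / (2 * ?r)"
  define c where "c = - D / (4 * ?r)"
  define b where "b = - (C + D / (2 * ?r)) / (2 * ?r)"
  have K: "K = 2 * ?r * k" and D: "D = - (4 * ?r * c)" and C: "C = 2 * c - 2 * ?r * b"
    using r by (auto simp: k_def c_def b_def field_simps)
  let ?P = "\<lambda>t. k * of_real t * of_real (exp (r * t))
    + (b * of_real t + c * of_real t * of_real t) * of_real (exp (- r * t))"
  let ?P' = "\<lambda>t. (k + k * ?r * of_real t) * of_real (exp (r * t))
    + (b + 2 * c * of_real t - ?r * (b * of_real t + c * of_real t * of_real t)) * of_real (exp (- r * t))"
  have P: "((\<lambda>t. f t - ?P t) has_vector_derivative (f' t - ?P' t)) (at t)" if "t > 0" for t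
    by (rule derivative_eq_intros has_vector_derivative_exp_of_real has_vector_derivative_complex_of_real f[OF that] f'[OF that] refl)+
      (simp add: algebra_simps power2_eq_square)
  have P': "((\<lambda>t. f' t - ?P' t) has_vector_derivative (?r ^ 2 * (f t - ?P t))) (at t)" if "t > 0" for t
    unfolding K D C
    by (rule derivative_eq_intros has_vector_derivative_exp_of_real has_vector_derivative_complex_of_real f[OF that] f'[OF that, unfolded K D C] refl)+
      (simp add: algebra_simps power2_eq_square)
  obtain A B where AB: "\<And>t. t > 0 \<Longrightarrow>
      f t - ?P t = A * of_real (exp (r * t)) + B * of_real (exp (- r * t))"
    using helmholtz_homogeneous[OF r P P'] by blast
  have "f t = (A + k * of_real t) * of_real (exp (r * t))
      + (B + b * of_real t + c * of_real t ^ 2) * of_real (exp (- r * t))" if "t > 0" for t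
    using AB[OF that] by (simp add: algebra_simps power2_eq_square)
  then show ?thesis
    by (intro that[of A B b]) (auto simp: k_def c_def b_def)
qed

text \<open>
  Multiplication by \<open>e\<^sup>-\<^sup>r\<^sup>t\<close> shows \<open>A + K t \<longlonglongrightarrow> 0\<close>; dividing by \<open>t\<close> gives \<open>K = 0\<close>, and then \<open>A = 0\<close>.
\<close>

lemma decaying_quasipolynomial:
  fixes A K a b c :: complex
  assumes r: "r > 0"
    and lim: "(f \<longlongrightarrow> 0) at_top"
    and f: "\<And>t. t > 0 \<Longrightarrow> f t = (A + K * of_real t) * of_real (exp (r * t))
        + (a + b * of_real t + c * of_real t ^ 2) * of_real (exp (- r * t))"
  shows "A = 0" "K = 0"
proof -
  have z: "((\<lambda>t. complex_of_real (g t)) \<longlongrightarrow> 0) at_top" if "(g \<longlongrightarrow> 0) at_top" for g :: "real \<Rightarrow> real"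
    using tendsto_of_real[OF that, where 'a = complex] by simp
  have e: "((\<lambda>t. exp (- r * t)) \<longlongrightarrow> 0) at_top" "((\<lambda>t. exp (- 2 * r * t)) \<longlongrightarrow> 0) at_top"
    "((\<lambda>t. t * exp (- 2 * r * t)) \<longlongrightarrow> 0) at_top" "((\<lambda>t. t ^ 2 * exp (- 2 * r * t)) \<longlongrightarrow> 0) at_top"
    using r by real_asymp+
  have "((\<lambda>t. f t * of_real (exp (- r * t)) - (a * of_real (exp (- 2 * r * t)) +
      b * of_real (t * exp (- 2 * r * t)) + c * of_real (t ^ 2 * exp (- 2 * r * t))))
      \<longlongrightarrow> 0 * 0 - (a * 0 + b * 0 + c * 0)) at_top"
    by (intro tendsto_intros lim z e)
  moreover have "\<forall>\<^sub>F t in at_top. f t * of_real (exp (- r * t)) - (a * of_real (exp (- 2 * r * t)) +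
      b * of_real (t * exp (- 2 * r * t)) + c * of_real (t ^ 2 * exp (- 2 * r * t))) = A + K * of_real t"
    using eventually_gt_at_top[of 0]
  proof eventually_elim
    case (elim t)
    have 1: "complex_of_real (exp (r * t)) * of_real (exp (- r * t)) = 1"
      by (simp flip: of_real_mult exp_add)
    have 2: "complex_of_real (exp (- 2 * r * t)) = of_real (exp (- r * t)) * of_real (exp (- r * t))"
      by (simp flip: of_real_mult exp_add)
    have "f t * of_real (exp (- r * t)) = (A + K * of_real t) * (of_real (exp (r * t)) * of_real (exp (- r * t)))
        + (a + b * of_real t + c * of_real t ^ 2) * of_real (exp (- 2 * r * t))"
      unfolding f[OF elim] 2 by (simp only: algebra_simps)
    then show ?case unfolding 1 by (simp add: algebra_simps)
  qed
  ultimately have L: "((\<lambda>t. A + K * of_real t) \<longlongrightarrow> 0) at_top"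
    by (simp add: tendsto_cong)
  have i: "((\<lambda>t::real. 1 / t) \<longlongrightarrow> 0) at_top" by real_asymp
  have "((\<lambda>t. (A + K * of_real t) * of_real (1 / t) - A * of_real (1 / t)) \<longlongrightarrow> 0 * 0 - A * 0) at_top"
    by (intro tendsto_intros L z i)
  moreover have "\<forall>\<^sub>F t in at_top. (A + K * of_real t) * of_real (1 / t) - A * of_real (1 / t) = K"
    using eventually_gt_at_top[of 0] by eventually_elim (simp add: field_simps)
  ultimately have "((\<lambda>t::real. K) \<longlongrightarrow> 0) at_top"
    by (simp add: tendsto_cong)
  then show "K = 0" by (simp add: tendsto_const_iff)
  with L show "A = 0" by (simp add: tendsto_const_iff)
qed

text \<open>
  The fourth-order equation is integrated twice: for \<open>w = u'' - r\<^sup>2 u\<close> it reads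
  \<open>w'' - r\<^sup>2 w = const \<cdot> e\<^sup>-\<^sup>r\<^sup>t\<close>, and the resulting \<open>w\<close> is the forcing in \<open>u'' - r\<^sup>2 u = w\<close>. Decay of \<open>u\<close>
  then removes the growing part. The factor \<open>8r\<^sup>2\<close> makes \<open>d\<close> the coefficient of \<open>t\<^sup>2\<close>, because
  \<open>(D\<^sup>2 - r\<^sup>2)\<^sup>2(t\<^sup>2 e\<^sup>-\<^sup>r\<^sup>t) = 8r\<^sup>2 e\<^sup>-\<^sup>r\<^sup>t\<close>.
\<close>

lemma decaying_biharmonic:
  fixes u :: "real \<Rightarrow> complex"
  assumes r: "r > 0" and u: "times_differentiable_pos 4 u" and lim: "(u \<longlongrightarrow> 0) at_top"
    and eq: "\<And>t. t > 0 \<Longrightarrow> (vderiv ^^ 4) u t - 2 * of_real r ^ 2 * (vderiv ^^ 2) u t + of_real r ^ 4 * u t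
        = 8 * of_real r ^ 2 * d * of_real (exp (- r * t))"
  obtains a b where "\<And>t. t > 0 \<Longrightarrow>
    u t = (a + b * of_real t + d * of_real t ^ 2) * of_real (exp (- r * t))"
proof -
  let ?r = "complex_of_real r"
  note D = has_vector_derivative_vderiv_funpow[OF u]
  let ?w = "\<lambda>t. (vderiv ^^ 2) u t - ?r ^ 2 * u t"
  let ?w' = "\<lambda>t. (vderiv ^^ 3) u t - ?r ^ 2 * (vderiv ^^ 1) u t"
  have 1: "(?w has_vector_derivative ?w' t) (at t)" if "t > 0" for t
    using D[of 2 t] D[of 0 t] that
    by (auto intro!: derivative_eq_intros simp: eval_nat_numeral)
  have 2: "(?w' has_vector_derivative ?r ^ 2 * ?w t +
      (0 * of_real (exp (r * t)) + (8 * ?r ^ 2 * d + 0 * of_real t) * of_real (exp (- r * t)))) (at t)" if "t > 0" for t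
  proof -
    have "(?w' has_vector_derivative (vderiv ^^ 4) u t - ?r ^ 2 * (vderiv ^^ 2) u t) (at t)"
      using D[of 3 t] D[of 1 t] that
      by (auto intro!: derivative_eq_intros simp: eval_nat_numeral)
    moreover have "(vderiv ^^ 4) u t - ?r ^ 2 * (vderiv ^^ 2) u t = ?r ^ 2 * ?w t +
        (0 * of_real (exp (r * t)) + (8 * ?r ^ 2 * d + 0 * of_real t) * of_real (exp (- r * t)))"
      using eq[OF that] power_add[of ?r 2 2] by (simp add: algebra_simps)
    ultimately show ?thesis by simp
  qed
  obtain A B b where w: "\<And>t. t > 0 \<Longrightarrow> ?w t = (A + 0 / (2 * ?r) * of_real t) * of_real (exp (r * t))
      + (B + b * of_real t - 0 / (4 * ?r) * of_real t ^ 2) * of_real (exp (- r * t))"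
    "b = - (8 * ?r ^ 2 * d + 0 / (2 * ?r)) / (2 * ?r)"
    using helmholtz_resonant[OF r 1 2] by blast
  have b: "b = - (4 * ?r * d)"
    using w(2) r by (simp add: field_simps power2_eq_square)
  have 3: "(u has_vector_derivative (vderiv ^^ 1) u t) (at t)" if "t > 0" for t
    using D[of 0 t] that by simp
  have 4: "((vderiv ^^ 1) u has_vector_derivative ?r ^ 2 * u t +
      (A * of_real (exp (r * t)) + (B + b * of_real t) * of_real (exp (- r * t)))) (at t)" if "t > 0" for t
    using D[of 1 t] w(1)[of t] that by (simp add: eval_nat_numeral algebra_simps)
  obtain A' B' b' where *: "\<And>t. t > 0 \<Longrightarrow> u t = (A' + A / (2 * ?r) * of_real t) * of_real (exp (r * t))
      + (B' + b' * of_real t - b / (4 * ?r) * of_real t ^ 2) * of_real (exp (- r * t))"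
    using helmholtz_resonant[OF r 3 4] by blast
  have d: "- b / (4 * ?r) = d" using r b by simp
  have "u t = (A' + A / (2 * ?r) * of_real t) * of_real (exp (r * t))
      + (B' + b' * of_real t + d * of_real t ^ 2) * of_real (exp (- r * t))" if "t > 0" for t
    using *[OF that] unfolding d[symmetric] by simp
  note ** = this
  from decaying_quasipolynomial[OF r lim **] have "A' = 0" "A / (2 * ?r) = 0" by blast+
  with ** show ?thesis by (intro that[of B' b']) auto
qed

lemma vderiv_quasipolynomial:
  fixes f :: "real \<Rightarrow> complex"
  assumes f: "\<And>t. t > 0 \<Longrightarrow> f t = (a + b * of_real t + d * of_real t ^ 2) * of_real (exp (- r * t))"
    and t: "t > 0"
  shows "vderiv f t = ((b - of_real r * a) + (2 * d - of_real r * b) * of_real t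
      + (- of_real r * d) * of_real t ^ 2) * of_real (exp (- r * t))"
proof -
  let ?g = "\<lambda>t. (a + b * of_real t + d * (of_real t * of_real t)) * complex_of_real (exp (- r * t))"
  have "(?g has_vector_derivative ((b - of_real r * a) + (2 * d - of_real r * b) * of_real t
      + (- of_real r * d) * of_real t ^ 2) * of_real (exp (- r * t))) (at t)"
    by (rule derivative_eq_intros has_vector_derivative_exp_of_real has_vector_derivative_complex_of_real refl)+
      (simp add: algebra_simps power2_eq_square)
  then have "(f has_vector_derivative ((b - of_real r * a) + (2 * d - of_real r * b) * of_real t
      + (- of_real r * d) * of_real t ^ 2) * of_real (exp (- r * t))) (at t)"
    by (rule has_vector_derivative_transform_within_open[of _ _ _ "{0<..}"])
      (use f t in \<open>auto simp: power2_eq_square\<close>)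
  then show ?thesis
    unfolding vderiv_def by (rule vector_derivative_at)
qed

lemma quasipolynomial_trace:
  fixes f :: "real \<Rightarrow> complex"
  assumes "(f \<longlongrightarrow> 0) (at_right 0)"
    and f: "\<And>t. t > 0 \<Longrightarrow> f t = (a + b * of_real t + d * of_real t ^ 2) * of_real (exp (- r * t))"
  shows "a = 0"
proof -
  have "isCont (\<lambda>t. (a + b * of_real t + d * of_real t ^ 2) * complex_of_real (exp (- r * t))) 0"
    by (intro continuous_intros)
  then have "((\<lambda>t. (a + b * of_real t + d * of_real t ^ 2) * complex_of_real (exp (- r * t))) \<longlongrightarrow> a) (at_right 0)"
    by (auto simp: isCont_def intro: filterlim_mono at_le)
  moreover have "\<forall>\<^sub>F t in at_right 0.
      f t = (a + b * of_real t + d * of_real t ^ 2) * complex_of_real (exp (- r * t))"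
    using eventually_at_right_less[of "0::real"] by eventually_elim (rule f)
  ultimately have "(f \<longlongrightarrow> a) (at_right 0)"
    by (simp add: tendsto_cong)
  then show ?thesis
    using assms(1) tendsto_unique trivial_limit_at_right_real by blast
qed

section \<open>Uniqueness for the half-space system\<close>

text \<open>
  The divergence equation turns the Dirichlet traces into \<open>Du\<^sub>3 \<rightarrow> 0\<close>, so all lower-order terms of a
  wall-eddy condition drop out in the limit. The coefficient \<open>g\<close> of the tangential vorticity term
  is arbitrary, which covers both signs of \<open>\<gamma>\<close>.
\<close>

lemma wall_eddy_second_trace:
  fixes u1 u2 u3 v :: "real \<Rightarrow> complex"
  assumes div: "\<And>t. t > 0 \<Longrightarrow> vderiv u3 t + m1 * u1 t + m2 * u2 t = 0"
    and u: "(u1 \<longlongrightarrow> 0) (at_right 0)" "(u2 \<longlongrightarrow> 0) (at_right 0)"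
    and bc: "((\<lambda>t. v t - c * vderiv u3 t + g * (a * u1 t - b * u2 t)) \<longlongrightarrow> 0) (at_right 0)"
  shows "(v \<longlongrightarrow> 0) (at_right 0)"
proof -
  have lim: "((\<lambda>t. (v t - c * vderiv u3 t + g * (a * u1 t - b * u2 t))
      + c * (- (m1 * u1 t) - m2 * u2 t) - g * (a * u1 t - b * u2 t)) \<longlongrightarrow>
      0 + c * (- (m1 * 0) - m2 * 0) - g * (a * 0 - b * 0)) (at_right 0)"
    by (intro tendsto_intros bc u)
  have ev: "\<forall>\<^sub>F t in at_right 0. (v t - c * vderiv u3 t + g * (a * u1 t - b * u2 t))
      + c * (- (m1 * u1 t) - m2 * u2 t) - g * (a * u1 t - b * u2 t) = v t"
    using eventually_at_right_less[of "0::real"]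
  proof eventually_elim
    case (elim t)
    have "vderiv u3 t = - (m1 * u1 t) - m2 * u2 t" using div[OF elim] by algebra
    then show ?case by simp
  qed
  show ?thesis using Lim_transform_eventually[OF lim ev] by simp
qed

text \<open>
  The uniqueness argument, with the boundary conditions already reduced to the traces of \<open>u\<close> and of
  \<open>D\<^sup>2u\<^sub>1, D\<^sup>2u\<^sub>2\<close>. The pressure is only once differentiable by hypothesis. That \<open>p'\<close> is differentiable
  again follows from the divergence equation, which expresses \<open>Du\<^sub>3\<close> through \<open>u\<^sub>1, u\<^sub>2\<close> and thereby makes
  \<open>u\<^sub>3\<close> five times differentiable.
\<close>

lemma half_space_system_trivial:
  fixes u1 u2 u3 p :: "real \<Rightarrow> complex" and r e1 e2 :: real
  assumes r: "r > 0" "r ^ 2 = e1 ^ 2 + e2 ^ 2"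
    and reg: "times_differentiable_pos 4 u1" "times_differentiable_pos 4 u2"
      "times_differentiable_pos 4 u3" "times_differentiable_pos 1 p"
    and eq1: "\<And>t. t > 0 \<Longrightarrow> (vderiv ^^ 4) u1 t - 2 * of_real r ^ 2 * (vderiv ^^ 2) u1 t
        + of_real r ^ 4 * u1 t + \<i> * of_real e1 * p t = 0"
    and eq2: "\<And>t. t > 0 \<Longrightarrow> (vderiv ^^ 4) u2 t - 2 * of_real r ^ 2 * (vderiv ^^ 2) u2 t
        + of_real r ^ 4 * u2 t + \<i> * of_real e2 * p t = 0"
    and eq3: "\<And>t. t > 0 \<Longrightarrow> (vderiv ^^ 4) u3 t - 2 * of_real r ^ 2 * (vderiv ^^ 2) u3 t
        + of_real r ^ 4 * u3 t + vderiv p t = 0"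
    and div: "\<And>t. t > 0 \<Longrightarrow> vderiv u3 t + \<i> * of_real e1 * u1 t + \<i> * of_real e2 * u2 t = 0"
    and decay: "(u1 \<longlongrightarrow> 0) at_top" "(u2 \<longlongrightarrow> 0) at_top" "(u3 \<longlongrightarrow> 0) at_top" "(p \<longlongrightarrow> 0) at_top"
    and dirichlet: "(u1 \<longlongrightarrow> 0) (at_right 0)" "(u2 \<longlongrightarrow> 0) (at_right 0)" "(u3 \<longlongrightarrow> 0) (at_right 0)"
    and second: "((vderiv ^^ 2) u1 \<longlongrightarrow> 0) (at_right 0)" "((vderiv ^^ 2) u2 \<longlongrightarrow> 0) (at_right 0)"
    and t: "t > 0"
  shows "u1 t = 0 \<and> u2 t = 0 \<and> u3 t = 0 \<and> p t = 0"
proof -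
  let ?r = "complex_of_real r"
  define m1 where "m1 = - \<i> * complex_of_real e1"
  define m2 where "m2 = - \<i> * complex_of_real e2"
  have m: "m1 * m1 + m2 * m2 = - (?r * ?r)"
    using arg_cong[OF r(2), of complex_of_real] by (simp add: m1_def m2_def power2_eq_square algebra_simps)
  have div': "vderiv u3 t = m1 * u1 t + m2 * u2 t" if "t > 0" for t
    using div[OF that] unfolding m1_def m2_def by algebra
  have u3_Suc: "(vderiv ^^ Suc k) u3 t = m1 * (vderiv ^^ k) u1 t + m2 * (vderiv ^^ k) u2 t"
    if "k \<le> 4" "t > 0" for k t
  proof -
    have "(vderiv ^^ Suc k) u3 t = (vderiv ^^ k) (\<lambda>x. m1 * u1 x + m2 * u2 x) t"
      using vderiv_funpow_cong_pos[of "vderiv u3" "\<lambda>x. m1 * u1 x + m2 * u2 x", OF div' \<open>t > 0\<close>]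
      by (simp only: funpow_Suc_right comp_apply)
    also have "\<dots> = m1 * (vderiv ^^ k) u1 t + m2 * (vderiv ^^ k) u2 t"
      by (rule vderiv_funpow_lincomb[OF reg(1,2) that])
    finally show ?thesis .
  qed
  note D = has_vector_derivative_vderiv_funpow
  \<comment> \<open>The third momentum equation identifies this function with \<open>p'\<close>.\<close>
  define q where "q t = - ((vderiv ^^ 4) u3 t - 2 * ?r ^ 2 * (vderiv ^^ 2) u3 t + ?r ^ 4 * u3 t)" for t
  have pq: "vderiv p t = q t" if "t > 0" for t
    using eq3[OF that] unfolding q_def by algebra
  have p': "(p has_vector_derivative q t) (at t)" if "t > 0" for t
    using D[OF reg(4), of 0 t] pq that by simp
  have q': "(q has_vector_derivative ?r ^ 2 * p t) (at t)" if "t > 0" for t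
  proof -
    have "((vderiv ^^ 4) u3 has_vector_derivative m1 * (vderiv ^^ 4) u1 t + m2 * (vderiv ^^ 4) u2 t) (at t)"
    proof (rule has_vector_derivative_transform_within_open[of _ _ _ "{0<..}"])
      show "((\<lambda>t. m1 * (vderiv ^^ 3) u1 t + m2 * (vderiv ^^ 3) u2 t) has_vector_derivative
          m1 * (vderiv ^^ 4) u1 t + m2 * (vderiv ^^ 4) u2 t) (at t)"
        using D[OF reg(1), of 3 t] D[OF reg(2), of 3 t] that
        by (intro has_vector_derivative_add has_vector_derivative_mult_right) (simp_all add: eval_nat_numeral)
      show "m1 * (vderiv ^^ 3) u1 x + m2 * (vderiv ^^ 3) u2 x = (vderiv ^^ 4) u3 x" if "x \<in> {0<..}" for x
        using u3_Suc[of 3 x] that by (simp del: funpow.simps)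
    qed (use that in auto)
    moreover have "((vderiv ^^ 2) u3 has_vector_derivative m1 * (vderiv ^^ 2) u1 t + m2 * (vderiv ^^ 2) u2 t) (at t)"
      using D[OF reg(3), of 2 t] u3_Suc[of 2 t] that by (simp del: funpow.simps)
    moreover have "(u3 has_vector_derivative m1 * u1 t + m2 * u2 t) (at t)"
      using D[OF reg(3), of 0 t] div'[OF that] that by simp
    ultimately have "(q has_vector_derivative
        - ((m1 * (vderiv ^^ 4) u1 t + m2 * (vderiv ^^ 4) u2 t)
         - 2 * ?r ^ 2 * (m1 * (vderiv ^^ 2) u1 t + m2 * (vderiv ^^ 2) u2 t)
         + ?r ^ 4 * (m1 * u1 t + m2 * u2 t))) (at t)"
      unfolding q_def
      by (intro has_vector_derivative_minus has_vector_derivative_add has_vector_derivative_diff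
          has_vector_derivative_mult_right)
    moreover have "- ((m1 * (vderiv ^^ 4) u1 t + m2 * (vderiv ^^ 4) u2 t)
         - 2 * ?r ^ 2 * (m1 * (vderiv ^^ 2) u1 t + m2 * (vderiv ^^ 2) u2 t)
         + ?r ^ 4 * (m1 * u1 t + m2 * u2 t)) = ?r ^ 2 * p t"
    proof -
      have 1: "(vderiv ^^ 4) u1 t = 2 * ?r ^ 2 * (vderiv ^^ 2) u1 t - ?r ^ 4 * u1 t + m1 * p t"
        using eq1[OF that] by (simp add: m1_def add_eq_0_iff algebra_simps)
      have 2: "(vderiv ^^ 4) u2 t = 2 * ?r ^ 2 * (vderiv ^^ 2) u2 t - ?r ^ 4 * u2 t + m2 * p t"
        using eq2[OF that] by (simp add: m2_def add_eq_0_iff algebra_simps)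
      have "?r ^ 2 = - (m1 * m1 + m2 * m2)" by (simp add: m power2_eq_square)
      then have 3: "?r ^ 2 * p t = - (m1 * m1 + m2 * m2) * p t" by simp
      show ?thesis unfolding 1 2 3 by (simp add: algebra_simps)
    qed
    ultimately show ?thesis by simp
  qed
  obtain A c where p_AC: "\<And>t. t > 0 \<Longrightarrow> p t = A * of_real (exp (r * t)) + c * of_real (exp (- r * t))"
    using helmholtz_homogeneous[OF r(1) p' q'] by blast
  have "A = 0"
    by (rule decaying_quasipolynomial(1)[OF r(1) decay(4), of A 0 c 0 0]) (simp add: p_AC)
  with p_AC have p: "p t = c * of_real (exp (- r * t))" if "t > 0" for t
    using that by simp
  have "vderiv p t = - ?r * c * of_real (exp (- r * t))" if "t > 0" for t
    using vderiv_quasipolynomial[of p c 0 0 r t] p that by simp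
  note p_deriv = this
  \<comment> \<open>The coefficients of \<open>t\<^sup>2\<close> that the pressure induces in the velocity.\<close>
  define d1 where "d1 = m1 * c / (8 * ?r ^ 2)"
  define d2 where "d2 = m2 * c / (8 * ?r ^ 2)"
  define d3 where "d3 = c / (8 * ?r)"
  have dd: "8 * ?r ^ 2 * d1 = m1 * c" "8 * ?r ^ 2 * d2 = m2 * c" "8 * ?r ^ 2 * d3 = ?r * c"
    using r(1) by (simp_all add: d1_def d2_def d3_def power2_eq_square)
  have rhs: "(vderiv ^^ 4) u1 t - 2 * ?r ^ 2 * (vderiv ^^ 2) u1 t + ?r ^ 4 * u1 t
        = 8 * ?r ^ 2 * d1 * of_real (exp (- r * t))"
      "(vderiv ^^ 4) u2 t - 2 * ?r ^ 2 * (vderiv ^^ 2) u2 t + ?r ^ 4 * u2 t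
        = 8 * ?r ^ 2 * d2 * of_real (exp (- r * t))"
      "(vderiv ^^ 4) u3 t - 2 * ?r ^ 2 * (vderiv ^^ 2) u3 t + ?r ^ 4 * u3 t
        = 8 * ?r ^ 2 * d3 * of_real (exp (- r * t))" if "t > 0" for t
    using eq1[OF that] eq2[OF that] eq3[OF that] unfolding dd p[OF that] p_deriv[OF that] m1_def m2_def
    by algebra+
  obtain a1 b1 where u1: "\<And>t. t > 0 \<Longrightarrow> u1 t = (a1 + b1 * of_real t + d1 * of_real t ^ 2) * of_real (exp (- r * t))"
    using decaying_biharmonic[OF r(1) reg(1) decay(1) rhs(1)] by blast
  obtain a2 b2 where u2: "\<And>t. t > 0 \<Longrightarrow> u2 t = (a2 + b2 * of_real t + d2 * of_real t ^ 2) * of_real (exp (- r * t))"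
    using decaying_biharmonic[OF r(1) reg(2) decay(2) rhs(2)] by blast
  obtain a3 b3 where u3: "\<And>t. t > 0 \<Longrightarrow> u3 t = (a3 + b3 * of_real t + d3 * of_real t ^ 2) * of_real (exp (- r * t))"
    using decaying_biharmonic[OF r(1) reg(3) decay(3) rhs(3)] by blast
  have a: "a1 = 0" "a2 = 0" "a3 = 0"
    using quasipolynomial_trace[OF dirichlet(1) u1] quasipolynomial_trace[OF dirichlet(2) u2]
      quasipolynomial_trace[OF dirichlet(3) u3] by auto
  \<comment> \<open>\<open>D\<^sup>2((b t + d t\<^sup>2) e\<^sup>-\<^sup>r\<^sup>t)\<close> equals \<open>2d - 2rb\<close> at \<open>t = 0\<close>.\<close>
  have second_coeff: "d = ?r * b" if "((vderiv ^^ 2) f \<longlongrightarrow> 0) (at_right 0)"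
    "\<And>t. t > 0 \<Longrightarrow> f t = (0 + b * of_real t + d * of_real t ^ 2) * of_real (exp (- r * t))"
    for f b d
  proof -
    note d1 = vderiv_quasipolynomial[of f, OF that(2)]
    note d2 = vderiv_quasipolynomial[of "vderiv f", OF d1]
    have "((vderiv (vderiv f)) \<longlongrightarrow> 0) (at_right 0)"
      using that(1) by (simp add: eval_nat_numeral)
    from quasipolynomial_trace[OF this d2] show ?thesis by simp
  qed
  have b: "d1 = ?r * b1" "d2 = ?r * b2"
    using second_coeff[OF second(1) u1[unfolded a]] second_coeff[OF second(2) u2[unfolded a]] by auto
  \<comment> \<open>The divergence equation, divided by the common factor \<open>e\<^sup>-\<^sup>r\<^sup>t\<close>.\<close>
  have poly: "b3 + (2 * d3 - ?r * b3 - (m1 * b1 + m2 * b2)) * of_real t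
      + (- ?r * d3 - (m1 * d1 + m2 * d2)) * of_real t ^ 2 = 0" if "t > 0" for t
  proof -
    have "vderiv u3 t = (b3 + (2 * d3 - ?r * b3) * of_real t + (- ?r * d3) * of_real t ^ 2) * of_real (exp (- r * t))"
      using vderiv_quasipolynomial[OF u3 that] by (simp add: a)
    moreover have "vderiv u3 t = ((m1 * b1 + m2 * b2) * of_real t + (m1 * d1 + m2 * d2) * of_real t ^ 2) * of_real (exp (- r * t))"
      unfolding div'[OF that] u1[OF that] u2[OF that] by (simp add: a algebra_simps)
    ultimately have "(b3 + (2 * d3 - ?r * b3) * of_real t + (- ?r * d3) * of_real t ^ 2) =
        ((m1 * b1 + m2 * b2) * of_real t + (m1 * d1 + m2 * d2) * of_real t ^ 2)"
      by simp
    then show ?thesis by (simp add: algebra_simps)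
  qed
  have vanish: "x = 0 \<and> y = 0" if "\<And>t::real. t > 0 \<Longrightarrow> x + y * of_real t + z * of_real t ^ 2 = 0" for x y z :: complex
  proof -
    have "x + y + z = 0" "x + y * 2 + z * 4 = 0" "x + y * 3 + z * 9 = 0"
      using that[of 1] that[of 2] that[of 3] by simp_all
    then show ?thesis by algebra
  qed
  have "b3 = 0" "2 * d3 = m1 * b1 + m2 * b2"
    using vanish[OF poly] by auto
  \<comment> \<open>The right side is \<open>8r\<^sup>2\<close> times the difference of the two sides of \<open>2d\<^sub>3 = m\<^sub>1b\<^sub>1 + m\<^sub>2b\<^sub>2\<close>.\<close>
  have "3 * ?r * c = 8 * ?r * (?r * (2 * d3)) - 8 * ?r * (m1 * (?r * b1) + m2 * (?r * b2))"
  proof -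
    have "8 * ?r * (m1 * (?r * b1) + m2 * (?r * b2)) * ?r = 8 * ?r ^ 2 * d1 * m1 + 8 * ?r ^ 2 * d2 * m2"
      unfolding b by (simp add: algebra_simps power2_eq_square)
    also have "\<dots> = (m1 * m1 + m2 * m2) * c" unfolding dd by (simp add: algebra_simps)
    also have "\<dots> = (- (?r * c)) * ?r" unfolding m by simp
    finally have "8 * ?r * (m1 * (?r * b1) + m2 * (?r * b2)) * ?r = (- (?r * c)) * ?r" .
    moreover have "?r \<noteq> 0" using r(1) by simp
    ultimately have *: "8 * ?r * (m1 * (?r * b1) + m2 * (?r * b2)) = - (?r * c)"
      by (metis mult_right_cancel)
    have **: "8 * ?r * (?r * (2 * d3)) = 2 * ?r * c" using dd(3) by (simp add: power2_eq_square mult_ac)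
    show ?thesis unfolding * ** by simp
  qed
  also have "\<dots> = 0"
    unfolding \<open>2 * d3 = m1 * b1 + m2 * b2\<close> by (simp add: algebra_simps)
  finally have "c = 0" using r(1) by simp
  then have "d1 = 0" "d2 = 0" "d3 = 0" by (simp_all add: d1_def d2_def d3_def)
  moreover from this b r(1) have "b1 = 0" "b2 = 0" by auto
  ultimately show ?thesis
    using t by (simp add: u1 u2 u3 p a \<open>b3 = 0\<close> \<open>c = 0\<close>)
qed

section \<open>The operators evaluated on tangential frequencies\<close>

text \<open>
  The sum defining \<open>apply_op\<close> runs over the keys of \<open>P\<close>, which are not additive in \<open>P\<close>. Summing
  over any larger finite set makes linearity evident.
\<close>

lemma apply_op_superset:
  assumes "finite S" "Poly_Mapping.keys P \<subseteq> S"
  shows "apply_op \<eta> P f t = (\<Sum>\<alpha>\<in>S.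
     Poly_Mapping.lookup P \<alpha> * (\<i> * of_real (\<eta> $ 1)) ^ (\<alpha> $ 1) * (\<i> * of_real (\<eta> $ 2)) ^ (\<alpha> $ 2)
       * (vderiv ^^ (\<alpha> $ 3)) f t)"
  unfolding apply_op_def using assms by (intro sum.mono_neutral_left) (auto simp: in_keys_iff)

lemma apply_op_add: "apply_op \<eta> (P + Q) f t = apply_op \<eta> P f t + apply_op \<eta> Q f t"
proof -
  let ?S = "Poly_Mapping.keys P \<union> Poly_Mapping.keys Q"
  have "Poly_Mapping.keys (P + Q) \<subseteq> ?S" by (rule Poly_Mapping.keys_add)
  then show ?thesis
    by (simp add: apply_op_superset[of ?S] lookup_add sum.distrib algebra_simps)
qed

lemma apply_op_uminus: "apply_op \<eta> (- P) f t = - apply_op \<eta> P f t"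
  by (simp add: apply_op_def sum_negf)

lemma apply_op_diff: "apply_op \<eta> (P - Q) f t = apply_op \<eta> P f t - apply_op \<eta> Q f t"
  using apply_op_add[of \<eta> P "- Q"] by (simp add: apply_op_uminus)

lemma apply_op_zero: "apply_op \<eta> 0 f t = 0"
  by (simp add: apply_op_def)

lemma apply_op_single:
  "apply_op \<eta> (Poly_Mapping.single \<alpha> c) f t =
     c * (\<i> * of_real (\<eta> $ 1)) ^ (\<alpha> $ 1) * (\<i> * of_real (\<eta> $ 2)) ^ (\<alpha> $ 2) * (vderiv ^^ (\<alpha> $ 3)) f t"
  by (subst apply_op_superset[of "{\<alpha>}"]) auto

lemma apply_op_one: "apply_op \<eta> 1 f t = f t"
  using apply_op_single[of \<eta> 0 1] by simp

lemma apply_op_pd: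
  "apply_op \<eta> (pd 1) f t = \<i> * of_real (\<eta> $ 1) * f t"
  "apply_op \<eta> (pd 2) f t = \<i> * of_real (\<eta> $ 2) * f t"
  "apply_op \<eta> (pd 3) f t = vderiv f t"
  by (simp_all add: pd_def apply_op_single axis_def)

lemma laplacian_sq:
  "laplacian ^ 2 = (\<Sum>i\<in>UNIV. \<Sum>j\<in>UNIV. Poly_Mapping.single (axis i 2 + axis j 2) 1)"
proof -
  have "pd i ^ 2 = Poly_Mapping.single (axis i 2) 1" for i
    by (simp add: pd_def power2_eq_square mult_single axis_def vec_eq_iff cong: if_cong)
      (intro arg_cong2[where f = Poly_Mapping.single]; simp add: vec_eq_iff)
  then show ?thesis
    by (simp add: laplacian_def power2_eq_square[of "sum _ _"] sum_product mult_single)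
qed

lemma norm_sq_2: "norm \<eta> ^ 2 = (\<eta> $ 1) ^ 2 + (\<eta> $ 2) ^ 2" for \<eta> :: "real ^ 2"
  by (simp add: norm_vec_def L2_set_def sum_2)

lemma apply_op_laplacian_sq:
  "apply_op \<eta> (laplacian ^ 2) f t =
    (vderiv ^^ 4) f t - 2 * of_real (norm \<eta>) ^ 2 * (vderiv ^^ 2) f t + of_real (norm \<eta>) ^ 4 * f t"
proof -
  have n: "complex_of_real (norm \<eta>) ^ 2 = of_real (\<eta> $ 1) ^ 2 + of_real (\<eta> $ 2) ^ 2"
    by (simp only: norm_sq_2 flip: of_real_power of_real_add)
  have n4: "complex_of_real (norm \<eta>) ^ 4 = (complex_of_real (norm \<eta>) ^ 2) ^ 2"
    by (simp flip: power_mult)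
  have i4: "\<i> ^ 4 = (1 :: complex)" by (simp add: eval_nat_numeral)
  show ?thesis
    unfolding laplacian_sq n4 n sum_3 apply_op_add apply_op_single
    by (simp add: axis_def power_mult_distrib i4) (simp add: algebra_simps eval_nat_numeral)
qed

text \<open>
  The classical derivatives required of \<open>u\<^sub>j\<close> and \<open>p\<close> come from the monomials \<open>\<partial>\<^sub>3\<^sup>4\<close> of \<open>\<Delta>\<^sup>2\<close> and \<open>\<partial>\<^sub>3\<close> in
  the last column, once their coefficients are seen to be nonzero.
\<close>

lemma regular_for_L_op:
  assumes "regular_for L_op U"
  shows "times_differentiable_pos 4 (\<lambda>x. U x $ 1)" "times_differentiable_pos 4 (\<lambda>x. U x $ 2)"
    "times_differentiable_pos 4 (\<lambda>x. U x $ 3)" "times_differentiable_pos 1 (\<lambda>x. U x $ 4)"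
proof -
  have "Poly_Mapping.lookup (laplacian ^ 2) (axis 3 4) = 1"
    unfolding laplacian_sq
    by (simp add: sum_3 lookup_add lookup_single when_def axis_def vec_eq_iff forall_3)
  then have k4: "axis 3 4 \<in> Poly_Mapping.keys (laplacian ^ 2)" by (simp add: in_keys_iff)
  have k1: "axis 3 1 \<in> Poly_Mapping.keys (pd 3)" by (simp add: pd_def)
  have R: "times_differentiable_pos (\<alpha> $ 3) (\<lambda>x. U x $ j)" if "\<alpha> \<in> Poly_Mapping.keys (L_op $ i $ j)" for i j \<alpha>
    using assms that by (auto simp: regular_for_def)
  show "times_differentiable_pos 4 (\<lambda>x. U x $ 1)" "times_differentiable_pos 4 (\<lambda>x. U x $ 2)"
    "times_differentiable_pos 4 (\<lambda>x. U x $ 3)" "times_differentiable_pos 1 (\<lambda>x. U x $ 4)"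
    using R[of "axis 3 4" 1 1] R[of "axis 3 4" 2 2] R[of "axis 3 4" 3 3] R[of "axis 3 1" 3 4] k4 k1
    by (simp_all add: L_op_def vector_4 axis_def)
qed

lemma apply_mat_L_op:
  "apply_mat \<eta> L_op U t = vector [
     apply_op \<eta> (laplacian ^ 2) (\<lambda>x. U x $ 1) t + \<i> * of_real (\<eta> $ 1) * U t $ 4,
     apply_op \<eta> (laplacian ^ 2) (\<lambda>x. U x $ 2) t + \<i> * of_real (\<eta> $ 2) * U t $ 4,
     apply_op \<eta> (laplacian ^ 2) (\<lambda>x. U x $ 3) t + vderiv (\<lambda>x. U x $ 4) t,
     \<i> * of_real (\<eta> $ 1) * U t $ 1 + \<i> * of_real (\<eta> $ 2) * U t $ 2 + vderiv (\<lambda>x. U x $ 3) t]"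
  by (simp add: vec_eq_iff forall_4 apply_mat_def L_op_def vector_4 sum_4 apply_op_zero apply_op_pd)

lemma apply_mat_principal_B_op:
  "apply_mat \<eta> (principal_part bc_orders unk_orders (B_op \<gamma> k)) U t = vector [
     U t $ 1, U t $ 2, U t $ 3,
     (vderiv ^^ 2) (\<lambda>x. U x $ 2) t - \<i> * of_real (\<eta> $ 2) * vderiv (\<lambda>x. U x $ 3) t
       - of_real (\<gamma> * \<eta> $ 1) * (of_real (\<eta> $ 2) * U t $ 1 - of_real (\<eta> $ 1) * U t $ 2),
     - ((vderiv ^^ 2) (\<lambda>x. U x $ 1) t - \<i> * of_real (\<eta> $ 1) * vderiv (\<lambda>x. U x $ 3) t
       + of_real (\<gamma> * \<eta> $ 2) * (of_real (\<eta> $ 2) * U t $ 1 - of_real (\<eta> $ 1) * U t $ 2))]"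
  unfolding principal_part_B_op Let_def
  by (simp add: vec_eq_iff forall_5 apply_mat_def vector_5 vector_3 sum_4 u_field_def curl_def)
    (simp add: axis_def pd_def cst_def mult_single apply_op_zero apply_op_one apply_op_single
      apply_op_diff apply_op_uminus apply_op_add algebra_simps eval_nat_numeral)

lemma apply_mat_vanishing:
  assumes "\<And>t. t > 0 \<Longrightarrow> U t = 0" "t > 0"
  shows "apply_mat \<eta> A U t = 0"
  using assms by (simp add: apply_mat_def apply_op_def vec_eq_iff times_differentiable_pos_zero(2))

section \<open>The covering condition\<close>

theorem theorem3p5:
  fixes \<gamma> k :: real
  assumes "-1 \<le> \<gamma>" and "\<gamma> \<le> 1" and "k > 0"
  shows
    "(\<forall>\<eta>::real ^ 2. \<eta> \<noteq> 0 \<longrightarrow>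
       (\<forall>u1 u2 u3 p :: real \<Rightarrow> complex.
          (times_differentiable_pos 4 u1 \<and> times_differentiable_pos 4 u2 \<and>
           times_differentiable_pos 4 u3 \<and> times_differentiable_pos 1 p \<and>
           (\<forall>t>0. helm \<eta> (helm \<eta> u1) t + \<i> * of_real (\<eta> $ 1) * p t = 0) \<and>
           (\<forall>t>0. helm \<eta> (helm \<eta> u2) t + \<i> * of_real (\<eta> $ 2) * p t = 0) \<and>
           (\<forall>t>0. helm \<eta> (helm \<eta> u3) t + vderiv p t = 0) \<and>
           (\<forall>t>0. vderiv u3 t + \<i> * of_real (\<eta> $ 1) * u1 t + \<i> * of_real (\<eta> $ 2) * u2 t = 0) \<and>
           (u1 \<longlongrightarrow> 0) at_top \<and> (u2 \<longlongrightarrow> 0) at_top \<and>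
           (u3 \<longlongrightarrow> 0) at_top \<and> (p \<longlongrightarrow> 0) at_top \<and>
           (u1 \<longlongrightarrow> 0) (at_right 0) \<and> (u2 \<longlongrightarrow> 0) (at_right 0) \<and> (u3 \<longlongrightarrow> 0) (at_right 0) \<and>
           ((\<lambda>t. (vderiv ^^ 2) u2 t - \<i> * of_real (\<eta> $ 2) * vderiv u3 t
               + of_real (\<gamma> * \<eta> $ 1) * (of_real (\<eta> $ 2) * u1 t - of_real (\<eta> $ 1) * u2 t))
             \<longlongrightarrow> 0) (at_right 0) \<and>
           ((\<lambda>t. (vderiv ^^ 2) u1 t - \<i> * of_real (\<eta> $ 1) * vderiv u3 t
               + of_real (\<gamma> * \<eta> $ 2) * (of_real (\<eta> $ 2) * u1 t - of_real (\<eta> $ 1) * u2 t))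
             \<longlongrightarrow> 0) (at_right 0))
          \<longleftrightarrow> (\<forall>t>0. u1 t = 0 \<and> u2 t = 0 \<and> u3 t = 0 \<and> p t = 0)))
     \<and> covering_condition L_op (principal_part bc_orders unk_orders (B_op \<gamma> k))"
proof (intro conjI allI impI)
  fix \<eta> :: "real ^ 2" and u1 u2 u3 p :: "real \<Rightarrow> complex"
  assume "\<eta> \<noteq> 0"
  then have r: "norm \<eta> > 0" by simp
  show "(times_differentiable_pos 4 u1 \<and> times_differentiable_pos 4 u2 \<and>
           times_differentiable_pos 4 u3 \<and> times_differentiable_pos 1 p \<and>
           (\<forall>t>0. helm \<eta> (helm \<eta> u1) t + \<i> * of_real (\<eta> $ 1) * p t = 0) \<and>
           (\<forall>t>0. helm \<eta> (helm \<eta> u2) t + \<i> * of_real (\<eta> $ 2) * p t = 0) \<and>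
           (\<forall>t>0. helm \<eta> (helm \<eta> u3) t + vderiv p t = 0) \<and>
           (\<forall>t>0. vderiv u3 t + \<i> * of_real (\<eta> $ 1) * u1 t + \<i> * of_real (\<eta> $ 2) * u2 t = 0) \<and>
           (u1 \<longlongrightarrow> 0) at_top \<and> (u2 \<longlongrightarrow> 0) at_top \<and>
           (u3 \<longlongrightarrow> 0) at_top \<and> (p \<longlongrightarrow> 0) at_top \<and>
           (u1 \<longlongrightarrow> 0) (at_right 0) \<and> (u2 \<longlongrightarrow> 0) (at_right 0) \<and> (u3 \<longlongrightarrow> 0) (at_right 0) \<and>
           ((\<lambda>t. (vderiv ^^ 2) u2 t - \<i> * of_real (\<eta> $ 2) * vderiv u3 t
               + of_real (\<gamma> * \<eta> $ 1) * (of_real (\<eta> $ 2) * u1 t - of_real (\<eta> $ 1) * u2 t))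
             \<longlongrightarrow> 0) (at_right 0) \<and>
           ((\<lambda>t. (vderiv ^^ 2) u1 t - \<i> * of_real (\<eta> $ 1) * vderiv u3 t
               + of_real (\<gamma> * \<eta> $ 2) * (of_real (\<eta> $ 2) * u1 t - of_real (\<eta> $ 1) * u2 t))
             \<longlongrightarrow> 0) (at_right 0))
          \<longleftrightarrow> (\<forall>t>0. u1 t = 0 \<and> u2 t = 0 \<and> u3 t = 0 \<and> p t = 0)"
    (is "?solution \<longleftrightarrow> ?zero")
  proof
    assume S: ?solution
    have div: "vderiv u3 t + \<i> * of_real (\<eta> $ 1) * u1 t + \<i> * of_real (\<eta> $ 2) * u2 t = 0" if "t > 0" for t
      using S that by blast
    have traces: "(u1 \<longlongrightarrow> 0) (at_right 0)" "(u2 \<longlongrightarrow> 0) (at_right 0)" "(u3 \<longlongrightarrow> 0) (at_right 0)"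
      using S by blast+
    have "((\<lambda>t. (vderiv ^^ 2) u1 t - \<i> * of_real (\<eta> $ 1) * vderiv u3 t
        + of_real (\<gamma> * \<eta> $ 2) * (of_real (\<eta> $ 2) * u1 t - of_real (\<eta> $ 1) * u2 t)) \<longlongrightarrow> 0) (at_right 0)"
      using S by blast
    note second1 = wall_eddy_second_trace[OF div traces(1,2) this]
    have "((\<lambda>t. (vderiv ^^ 2) u2 t - \<i> * of_real (\<eta> $ 2) * vderiv u3 t
        + of_real (\<gamma> * \<eta> $ 1) * (of_real (\<eta> $ 2) * u1 t - of_real (\<eta> $ 1) * u2 t)) \<longlongrightarrow> 0) (at_right 0)"
      using S by blast
    note second2 = wall_eddy_second_trace[OF div traces(1,2) this]
    show ?zero
    proof (intro allI impI)
      fix t :: real assume t: "t > 0"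
      show "u1 t = 0 \<and> u2 t = 0 \<and> u3 t = 0 \<and> p t = 0"
        by (rule half_space_system_trivial[OF r norm_sq_2 _ _ _ _ _ _ _ div _ _ _ _ traces second1 second2 t])
          (use S in \<open>auto simp: helm_helm simp flip: of_real_power power_mult\<close>)
    qed
  next
    assume Z: ?zero
    then have z: "\<And>t. t > 0 \<Longrightarrow> u1 t = 0" "\<And>t. t > 0 \<Longrightarrow> u2 t = 0"
      "\<And>t. t > 0 \<Longrightarrow> u3 t = 0" "\<And>t. t > 0 \<Longrightarrow> p t = 0" by blast+
    have reg: "times_differentiable_pos m u1" "times_differentiable_pos m u2"
      "times_differentiable_pos m u3" "times_differentiable_pos m p" for m
      using z times_differentiable_pos_zero(1) by blast+
    have d: "(vderiv ^^ k) u1 t = 0" "(vderiv ^^ k) u2 t = 0" "(vderiv ^^ k) u3 t = 0"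
      "(vderiv ^^ k) p t = 0" if "t > 0" for k t
      using z that times_differentiable_pos_zero(2) by blast+
    have d1: "vderiv u3 t = 0" "vderiv p t = 0" if "t > 0" for t
      using d(3,4)[OF that, of 1] by simp_all
    show ?solution
      by (intro conjI allI impI vanishing_on_pos reg)
        (simp_all add: helm_helm reg z d d1 del: funpow.simps)
  qed
next
  show "covering_condition L_op (principal_part bc_orders unk_orders (B_op \<gamma> k))"
    unfolding covering_condition_def
  proof (intro allI impI)
    fix \<eta> :: "real ^ 2" and U :: "real \<Rightarrow> complex ^ 4"
    assume "\<eta> \<noteq> 0"
    then have r: "norm \<eta> > 0" by simp
    let ?B = "principal_part bc_orders unk_orders (B_op \<gamma> k)"
    show "(regular_for L_op U \<and> regular_for ?B U \<and> (\<forall>t>0. apply_mat \<eta> L_op U t = 0) \<and>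
        (U \<longlongrightarrow> 0) at_top \<and> (apply_mat \<eta> ?B U \<longlongrightarrow> 0) (at_right 0)) \<longleftrightarrow> (\<forall>t>0. U t = 0)"
      (is "?solution \<longleftrightarrow> ?zero")
    proof
      assume S: ?solution
      then have L: "apply_mat \<eta> L_op U t $ i = 0" if "t > 0" for t i
        using that by simp
      note L = L[unfolded apply_mat_L_op]
      have decay: "((\<lambda>t. U t $ i) \<longlongrightarrow> 0) at_top" for i
        using S tendsto_vec_nth[of U 0 at_top i] by simp
      have B: "((\<lambda>t. apply_mat \<eta> ?B U t $ i) \<longlongrightarrow> 0) (at_right 0)" for i
        using S tendsto_vec_nth[of "apply_mat \<eta> ?B U" 0 "at_right 0" i] by simp
      note B = B[unfolded apply_mat_principal_B_op]
      have div: "vderiv (\<lambda>x. U x $ 3) t + \<i> * of_real (\<eta> $ 1) * U t $ 1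
          + \<i> * of_real (\<eta> $ 2) * U t $ 2 = 0" if "t > 0" for t
        using L[OF that, of 4] by (simp add: vector_4 add_ac)
      have traces: "((\<lambda>t. U t $ 1) \<longlongrightarrow> 0) (at_right 0)" "((\<lambda>t. U t $ 2) \<longlongrightarrow> 0) (at_right 0)"
        "((\<lambda>t. U t $ 3) \<longlongrightarrow> 0) (at_right 0)"
        using B[of 1] B[of 2] B[of 3] by (simp_all add: vector_5)
      have "((\<lambda>t. (vderiv ^^ 2) (\<lambda>x. U x $ 1) t - \<i> * of_real (\<eta> $ 1) * vderiv (\<lambda>x. U x $ 3) t
          + of_real (\<gamma> * \<eta> $ 2) * (of_real (\<eta> $ 2) * U t $ 1 - of_real (\<eta> $ 1) * U t $ 2))
          \<longlongrightarrow> 0) (at_right 0)"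
        using tendsto_minus[OF B[of 5]] by (simp only: vector_5 minus_minus minus_zero)
      note second1 = wall_eddy_second_trace[OF div traces(1,2) this]
      have "((\<lambda>t. (vderiv ^^ 2) (\<lambda>x. U x $ 2) t - \<i> * of_real (\<eta> $ 2) * vderiv (\<lambda>x. U x $ 3) t
          + (- of_real (\<gamma> * \<eta> $ 1)) * (of_real (\<eta> $ 2) * U t $ 1 - of_real (\<eta> $ 1) * U t $ 2))
          \<longlongrightarrow> 0) (at_right 0)"
        using B[of 4] by (simp only: vector_5 mult_minus_left add_uminus_conv_diff)
      note second2 = wall_eddy_second_trace[OF div traces(1,2) this]
      have reg: "regular_for L_op U" using S by blast
      have eqs: "apply_op \<eta> (laplacian ^ 2) (\<lambda>x. U x $ 1) t + \<i> * of_real (\<eta> $ 1) * U t $ 4 = 0"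
        "apply_op \<eta> (laplacian ^ 2) (\<lambda>x. U x $ 2) t + \<i> * of_real (\<eta> $ 2) * U t $ 4 = 0"
        "apply_op \<eta> (laplacian ^ 2) (\<lambda>x. U x $ 3) t + vderiv (\<lambda>x. U x $ 4) t = 0" if "t > 0" for t
        using L[OF that, of 1] L[OF that, of 2] L[OF that, of 3] by (simp_all only: vector_4)
      show ?zero
      proof (intro allI impI)
        fix t :: real assume "t > 0"
        then show "U t = 0"
          using half_space_system_trivial[OF r norm_sq_2 regular_for_L_op[OF reg]
              eqs[unfolded apply_op_laplacian_sq] div decay decay decay decay traces second1 second2]
          by (simp add: vec_eq_iff forall_4)
      qed
    next
      assume Z: ?zero
      then have "regular_for L_op U" "regular_for ?B U"
        by (simp_all add: regular_for_def times_differentiable_pos_zero(1))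
      then show ?solution
        using Z by (auto intro!: vanishing_on_pos simp: apply_mat_vanishing)
    qed
  qed
qed

end
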